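(* Let $(\mathcal{L},[\cdot,\cdot]_{\mathcal{L},0},\alpha)$ and $(\mathcal{G},[\cdot,\cdot]_{\mathcal{G},0},\beta)$ be multiplicative Hom-Lie algebras over $\mathbb{K}$, let $\phi:\mathcal{L}\to\mathcal{G}$ be a Hom-Lie algebra morphism and let $\Theta_t=([\cdot,\cdot]_{\mathcal{L},t},[\cdot,\cdot]_{\mathcal{G},t},\phi_t)$ be an order $N$ one-parameter formal deformation of $\phi$ ($N\ge1$). Put $$\mathcal{O}b_{\mathcal{L}}(x,y,z)=-\sum_{\substack{p+q=N+1\\ p,q>0}}\Big([\alpha(x),[y,z]_{\mathcal{L},p}]_{\mathcal{L},q}+[\alpha(y),[z,x]_{\mathcal{L},p}]_{\mathcal{L},q}+[\alpha(z),[x,y]_{\mathcal{L},p}]_{\mathcal{L},q}\Big)\quad(x,y,z\in\mathcal{L}),$$ $\mathcal{O}b_{\mathcal{G}}$ given by the same formula on $\mathcal{G}$ (with $\beta$ and the brackets $[\cdot,\cdot]_{\mathcal{G},i}$), and, for $x,y\in\mathcal{L}$, $$\mathcal{O}b_\phi(x,y)=\sum_{i=1}^{N}\phi_i([x,y]_{\mathcal{L},N+1-i})-{\sum}'[\phi_i(x),\phi_j(y)]_{\mathcal{G},k},$$ where ${\sum}'$ runs over all triples $(i,j,k)$ of non-negative integers with $i+j+k=N+1$ and at least two of $i,j,k$ positive. Then $\mathcal{O}b=(\mathcal{O}b_{\mathcal{L}},\mathcal{O}b_{\mathcal{G}},\mathcal{O}b_\phi)\in Z^3_{HL}(\phi,\phi)$.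 Therefore, the deformation $\Theta_t$ extends to a deformation of order $N+1$ if and only if $\mathcal{O}b$ is a coboundary, i.e. $\mathcal{O}b\in B^3_{HL}(\phi,\phi)$.
   Context: $\mathbb{K}$ is an algebraically closed field of characteristic $0$. A Hom-Lie algebra $(\mathcal{L},[\cdot,\cdot],\alpha)$ is a vector space with a skew-symmetric bilinear bracket and a linear map $\alpha$ such that $[\alpha(x),[y,z]]+[\alpha(y),[z,x]]+[\alpha(z),[x,y]]=0$; it is multiplicative if $\alpha([x,y])=[\alpha(x),\alpha(y)]$. A Hom-Lie algebra morphism $\phi:\mathcal{L}\to\mathcal{G}$ is a linear map with $[\phi(x),\phi(y)]_{\mathcal{G},0}=\phi([x,y]_{\mathcal{L},0})$ and $\phi\circ\alpha=\beta\circ\phi$. Cohomology: for $n\ge1$, $\widetilde{C}^n_{\alpha,\beta}(\mathcal{L},\mathcal{G})$ is the space of skew-symmetric $n$-linear maps $f:\mathcal{L}^{\times n}\to\mathcal{G}$ with $\beta(f(u_1,\dots,u_n))=f(\alpha(u_1),\dots,\alpha(u_n))$, with $$\delta^n_{HL}\varphi(x_0,\dots,x_n)=\sum_{i=0}^n(-1)^i[\phi(\alpha^{n-1}(x_i)),\varphi(x_0,\dots,\widehat{x_i},\dots,x_n)]_{\mathcal{G},0}+\sum_{0\le i<j\le n}(-1)^{i+j}\varphi([x_i,x_j]_{\mathcal{L},0},\alpha(x_0),\dots,\widehat{x_i},\dots,\widehat{x_j},\dots,\alpha(x_n)).$$ $C^n_{HL}(\mathcal{L},\mathcal{L})$ and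 $C^n_{HL}(\mathcal{G},\mathcal{G})$ with their $\delta^n_{HL}$ are the case $\phi=\mathrm{id}$. For $n\ge2$, $C^n_{HL}(\phi,\phi)=C^n_{HL}(\mathcal{L},\mathcal{L})\times C^n_{HL}(\mathcal{G},\mathcal{G})\times\widetilde{C}^{n-1}_{\alpha,\beta}(\mathcal{L},\mathcal{G})$ and $\delta^n(\varphi_1,\varphi_2,\varphi_3)=(\delta^n_{HL}\varphi_1,\delta^n_{HL}\varphi_2,\delta^{n-1}_{HL}\varphi_3+(-1)^{n-1}(\phi\circ\varphi_1-\varphi_2\diamond\phi))$, where $(\varphi_2\diamond\phi)(x_1,\dots,x_n)=\varphi_2(\phi(x_1),\dots,\phi(x_n))$. $Z^3_{HL}(\phi,\phi)=\ker\delta^3$, $B^3_{HL}(\phi,\phi)=\mathrm{im}\,\delta^2$. Deformations of order $N$: a triple $\Theta_t=([\cdot,\cdot]_{\mathcal{L},t},[\cdot,\cdot]_{\mathcal{G},t},\phi_t)$ with $[\cdot,\cdot]_{\mathcal{L},t}=\sum_{i=0}^Nt^i[\cdot,\cdot]_{\mathcal{L},i}$, $[\cdot,\cdot]_{\mathcal{G},t}=\sum_{i=0}^Nt^i[\cdot,\cdot]_{\mathcal{G},i}$, $\phi_t=\sum_{i=0}^N\phi_it^i$, $\phi_0=\phi$, where the $[\cdot,\cdot]_{\mathcal{L},i}$, $[\cdot,\cdot]_{\mathcal{G},i}$ are skew-symmetric bilinear maps commuting with $\alpha$, $\beta$ respectively (i.e. in $C^2_{HL}$), the $\phi_i:\mathcal{L}\to\mathcal{G}$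 are linear with $\phi_i\circ\alpha=\beta\circ\phi_i$, such that for every $0\le n\le N$: $\sum_{p+q=n}\big([\alpha(x),[y,z]_{\mathcal{L},p}]_{\mathcal{L},q}+[\alpha(y),[z,x]_{\mathcal{L},p}]_{\mathcal{L},q}+[\alpha(z),[x,y]_{\mathcal{L},p}]_{\mathcal{L},q}\big)=0$, the same for $\mathcal{G}$, and $\sum_{i=0}^n\phi_i([x,y]_{\mathcal{L},n-i})=\sum_{i+j+k=n}[\phi_i(x),\phi_j(y)]_{\mathcal{G},k}$. It extends to order $N+1$ if there is a $2$-cochain $\theta_{N+1}=([\cdot,\cdot]_{\mathcal{L},N+1},[\cdot,\cdot]_{\mathcal{G},N+1},\phi_{N+1})\in C^2_{HL}(\phi,\phi)$ such that $\Theta_t+t^{N+1}\theta_{N+1}$ is a deformation of order $N+1$. *)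

theory Defs
  imports Complex_Main "HOL-Computational_Algebra.Polynomial"
begin

text \<open>
  A Hom-Lie algebra on the vector space given by a type \<open>'a\<close> with scalar multiplication \<open>smul\<close>
  over \<open>'k\<close>; \<open>twist\<close> is the structure map (written alpha or beta).
\<close>

record ('k, 'a) hom_lie =
  smul :: "'k \<Rightarrow> 'a \<Rightarrow> 'a"
  bracket :: "'a \<Rightarrow> 'a \<Rightarrow> 'a"
  twist :: "'a \<Rightarrow> 'a"

definition hom_lie_algebra :: "('k::field, 'a::ab_group_add) hom_lie \<Rightarrow> bool" where
  "hom_lie_algebra L \<longleftrightarrow>
     vector_space (smul L) \<and>
     (\<forall>x. Vector_Spaces.linear (smul L) (smul L) (\<lambda>y. bracket L x y)) \<and>
     (\<forall>y. Vector_Spaces.linear (smul L) (smul L) (\<lambda>x. bracket L x y)) \<and>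
     (\<forall>x y. bracket L x y = - bracket L y x) \<and>
     Vector_Spaces.linear (smul L) (smul L) (twist L) \<and>
     (\<forall>x y z. bracket L (twist L x) (bracket L y z)
            + bracket L (twist L y) (bracket L z x)
            + bracket L (twist L z) (bracket L x y) = 0)"

definition multiplicative_hom_lie_algebra ::
    "('k::field, 'a::ab_group_add) hom_lie \<Rightarrow> bool" where
  "multiplicative_hom_lie_algebra L \<longleftrightarrow>
     hom_lie_algebra L \<and>
     (\<forall>x y. twist L (bracket L x y) = bracket L (twist L x) (twist L y))"

definition hom_lie_morphism ::
    "('k::field, 'a::ab_group_add) hom_lie \<Rightarrow> ('k, 'b::ab_group_add) hom_lie \<Rightarrow> ('a \<Rightarrow> 'b) \<Rightarrow> bool" where
  "hom_lie_morphism L G \<phi> \<longleftrightarrow>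
     Vector_Spaces.linear (smul L) (smul G) \<phi> \<and>
     (\<forall>x y. bracket G (\<phi> x) (\<phi> y) = \<phi> (bracket L x y)) \<and>
     \<phi> \<circ> twist L = twist G \<circ> \<phi>"


section \<open>Cochains\<close>

text \<open>
  An \<open>n\<close>-cochain is a function on argument lists. Only lists of length \<open>n\<close> matter; the value on
  all other lists is fixed to be \<open>0\<close>, so that equality of cochains is equality of functions.
  The spaces and coboundaries below are meant for \<open>n \<ge> 1\<close> (\<open>n \<ge> 2\<close> for those of a morphism).
\<close>

definition cochains ::
    "('k::field, 'a::ab_group_add) hom_lie \<Rightarrow> ('k, 'b::ab_group_add) hom_lie \<Rightarrow> nat
      \<Rightarrow> ('a list \<Rightarrow> 'b) set" where
  "cochains L G n = {f.
     (\<forall>xs. length xs \<noteq> n \<longrightarrow> f xs = 0) \<and>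
     (\<forall>xs i. length xs = n \<longrightarrow> i < n \<longrightarrow>
        Vector_Spaces.linear (smul L) (smul G) (\<lambda>v. f (xs[i := v]))) \<and>
     (\<forall>xs i j. length xs = n \<longrightarrow> i < j \<longrightarrow> j < n \<longrightarrow>
        f (xs[i := xs ! j, j := xs ! i]) = - f xs) \<and>
     (\<forall>xs. length xs = n \<longrightarrow> twist G (f xs) = f (map (twist L) xs))}"

text \<open>\<open>nths xs (- A)\<close> is the list \<open>xs\<close> with the entries at the positions in \<open>A\<close> omitted.\<close>

definition delta_HL ::
    "('k::field, 'a::ab_group_add) hom_lie \<Rightarrow> ('k, 'b::ab_group_add) hom_lie \<Rightarrow> ('a \<Rightarrow> 'b) \<Rightarrow> nat
      \<Rightarrow> ('a list \<Rightarrow> 'b) \<Rightarrow> ('a list \<Rightarrow> 'b)" where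
  "delta_HL L G \<phi> n f = (\<lambda>xs. if length xs = Suc n then
       (\<Sum>i\<in>{0..n}. smul G ((- 1) ^ i)
          (bracket G (\<phi> ((twist L ^^ (n - 1)) (xs ! i))) (f (nths xs (- {i})))))
     + (\<Sum>(i, j)\<in>{(i, j). i < j \<and> j \<le> n}. smul G ((- 1) ^ (i + j))
          (f (bracket L (xs ! i) (xs ! j) # map (twist L) (nths xs (- {i, j})))))
     else 0)"

type_synonym ('a, 'b) mor_cochain =
  "('a list \<Rightarrow> 'a) \<times> ('b list \<Rightarrow> 'b) \<times> ('a list \<Rightarrow> 'b)"

definition mor_cochains ::
    "('k::field, 'a::ab_group_add) hom_lie \<Rightarrow> ('k, 'b::ab_group_add) hom_lie \<Rightarrow> nat
      \<Rightarrow> ('a, 'b) mor_cochain set" where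
  "mor_cochains L G n = cochains L L n \<times> cochains G G n \<times> cochains L G (n - 1)"

definition mor_delta ::
    "('k::field, 'a::ab_group_add) hom_lie \<Rightarrow> ('k, 'b::ab_group_add) hom_lie \<Rightarrow> ('a \<Rightarrow> 'b) \<Rightarrow> nat
      \<Rightarrow> ('a, 'b) mor_cochain \<Rightarrow> ('a, 'b) mor_cochain" where
  "mor_delta L G \<phi> n = (\<lambda>(f1, f2, f3).
     (delta_HL L L id n f1,
      delta_HL G G id n f2,
      (\<lambda>xs. delta_HL L G \<phi> (n - 1) f3 xs
            + smul G ((- 1) ^ (n - 1)) (\<phi> (f1 xs) - f2 (map \<phi> xs)))))"

definition mor_cocycles3 ::
    "('k::field, 'a::ab_group_add) hom_lie \<Rightarrow> ('k, 'b::ab_group_add) hom_lie \<Rightarrow> ('a \<Rightarrow> 'b)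
      \<Rightarrow> ('a, 'b) mor_cochain set" where
  "mor_cocycles3 L G \<phi> =
     {c \<in> mor_cochains L G 3. mor_delta L G \<phi> 3 c = (\<lambda>_. 0, \<lambda>_. 0, \<lambda>_. 0)}"

definition mor_coboundaries3 ::
    "('k::field, 'a::ab_group_add) hom_lie \<Rightarrow> ('k, 'b::ab_group_add) hom_lie \<Rightarrow> ('a \<Rightarrow> 'b)
      \<Rightarrow> ('a, 'b) mor_cochain set" where
  "mor_coboundaries3 L G \<phi> = mor_delta L G \<phi> 2 ` mor_cochains L G 2"

definition cochain1 :: "('a \<Rightarrow> 'b) \<Rightarrow> 'a list \<Rightarrow> 'b::zero" where
  "cochain1 f xs = (case xs of [x] \<Rightarrow> f x | _ \<Rightarrow> 0)"

definition cochain2 :: "('a \<Rightarrow> 'a \<Rightarrow> 'b) \<Rightarrow> 'a list \<Rightarrow> 'b::zero" where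
  "cochain2 f xs = (case xs of [x, y] \<Rightarrow> f x y | _ \<Rightarrow> 0)"

definition cochain3 :: "('a \<Rightarrow> 'a \<Rightarrow> 'a \<Rightarrow> 'b) \<Rightarrow> 'a list \<Rightarrow> 'b::zero" where
  "cochain3 f xs = (case xs of [x, y, z] \<Rightarrow> f x y z | _ \<Rightarrow> 0)"


section \<open>Deformations of finite order\<close>

text \<open>
  A deformation is given by its coefficients: \<open>mL i\<close>, \<open>mG i\<close> and \<open>ph i\<close> are the coefficients of
  \<open>t\<^sup>i\<close> in the two brackets and in the morphism. For order \<open>N\<close> only the indices \<open>i \<le> N\<close> matter;
  the remaining values of the sequences are ignored.
\<close>

definition hom_jacobi_sum ::
    "('a \<Rightarrow> 'a) \<Rightarrow> ('a \<Rightarrow> 'a \<Rightarrow> 'a) \<Rightarrow> ('a \<Rightarrow> 'a \<Rightarrow> 'a) \<Rightarrow> 'a \<Rightarrow> 'a \<Rightarrow> 'a \<Rightarrow> 'a::ab_group_add" where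
  "hom_jacobi_sum a mp mq x y z = mq (a x) (mp y z) + mq (a y) (mp z x) + mq (a z) (mp x y)"

definition is_deformation ::
    "('k::field, 'a::ab_group_add) hom_lie \<Rightarrow> ('k, 'b::ab_group_add) hom_lie \<Rightarrow> ('a \<Rightarrow> 'b) \<Rightarrow> nat
      \<Rightarrow> (nat \<Rightarrow> 'a \<Rightarrow> 'a \<Rightarrow> 'a) \<Rightarrow> (nat \<Rightarrow> 'b \<Rightarrow> 'b \<Rightarrow> 'b) \<Rightarrow> (nat \<Rightarrow> 'a \<Rightarrow> 'b) \<Rightarrow> bool" where
  "is_deformation L G \<phi> N mL mG ph \<longleftrightarrow>
     mL 0 = bracket L \<and> mG 0 = bracket G \<and> ph 0 = \<phi> \<and>
     (\<forall>i\<le>N. cochain2 (mL i) \<in> cochains L L 2) \<and>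
     (\<forall>i\<le>N. cochain2 (mG i) \<in> cochains G G 2) \<and>
     (\<forall>i\<le>N. Vector_Spaces.linear (smul L) (smul G) (ph i) \<and> ph i \<circ> twist L = twist G \<circ> ph i) \<and>
     (\<forall>n\<le>N. \<forall>x y z. (\<Sum>(p, q)\<in>{(p, q). p + q = n}.
        hom_jacobi_sum (twist L) (mL p) (mL q) x y z) = 0) \<and>
     (\<forall>n\<le>N. \<forall>x y z. (\<Sum>(p, q)\<in>{(p, q). p + q = n}.
        hom_jacobi_sum (twist G) (mG p) (mG q) x y z) = 0) \<and>
     (\<forall>n\<le>N. \<forall>x y. (\<Sum>i\<in>{0..n}. ph i (mL (n - i) x y)) =
        (\<Sum>(i, j, k)\<in>{(i, j, k). i + j + k = n}. mG k (ph i x) (ph j y)))"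

definition extends_to_next_order ::
    "('k::field, 'a::ab_group_add) hom_lie \<Rightarrow> ('k, 'b::ab_group_add) hom_lie \<Rightarrow> ('a \<Rightarrow> 'b) \<Rightarrow> nat
      \<Rightarrow> (nat \<Rightarrow> 'a \<Rightarrow> 'a \<Rightarrow> 'a) \<Rightarrow> (nat \<Rightarrow> 'b \<Rightarrow> 'b \<Rightarrow> 'b) \<Rightarrow> (nat \<Rightarrow> 'a \<Rightarrow> 'b) \<Rightarrow> bool" where
  "extends_to_next_order L G \<phi> N mL mG ph \<longleftrightarrow>
     (\<exists>bL bG p. (cochain2 bL, cochain2 bG, cochain1 p) \<in> mor_cochains L G 2 \<and>
        is_deformation L G \<phi> (N + 1) (mL(N + 1 := bL)) (mG(N + 1 := bG)) (ph(N + 1 := p)))"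


section \<open>The obstruction\<close>

definition Ob_bracket ::
    "('a \<Rightarrow> 'a) \<Rightarrow> nat \<Rightarrow> (nat \<Rightarrow> 'a \<Rightarrow> 'a \<Rightarrow> 'a) \<Rightarrow> 'a \<Rightarrow> 'a \<Rightarrow> 'a \<Rightarrow> 'a::ab_group_add" where
  "Ob_bracket a N m x y z =
     - (\<Sum>(p, q)\<in>{(p, q). p + q = N + 1 \<and> p > 0 \<and> q > 0}. hom_jacobi_sum a (m p) (m q) x y z)"

definition Ob_morphism ::
    "nat \<Rightarrow> (nat \<Rightarrow> 'a \<Rightarrow> 'a \<Rightarrow> 'a) \<Rightarrow> (nat \<Rightarrow> 'b \<Rightarrow> 'b \<Rightarrow> 'b) \<Rightarrow> (nat \<Rightarrow> 'a \<Rightarrow> 'b)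
      \<Rightarrow> 'a \<Rightarrow> 'a \<Rightarrow> 'b::ab_group_add" where
  "Ob_morphism N mL mG ph x y =
     (\<Sum>i\<in>{1..N}. ph i (mL (N + 1 - i) x y))
     - (\<Sum>(i, j, k)\<in>{(i, j, k). i + j + k = N + 1 \<and>
            (i > 0 \<and> j > 0 \<or> i > 0 \<and> k > 0 \<or> j > 0 \<and> k > 0)}. mG k (ph i x) (ph j y))"

definition Ob ::
    "('k::field, 'a::ab_group_add) hom_lie \<Rightarrow> ('k, 'b::ab_group_add) hom_lie \<Rightarrow> nat
      \<Rightarrow> (nat \<Rightarrow> 'a \<Rightarrow> 'a \<Rightarrow> 'a) \<Rightarrow> (nat \<Rightarrow> 'b \<Rightarrow> 'b \<Rightarrow> 'b) \<Rightarrow> (nat \<Rightarrow> 'a \<Rightarrow> 'b)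
      \<Rightarrow> ('a, 'b) mor_cochain" where
  "Ob L G N mL mG ph =
     (cochain3 (Ob_bracket (twist L) N mL),
      cochain3 (Ob_bracket (twist G) N mG),
      cochain2 (Ob_morphism N mL mG ph))"

end

(* Let J_L, J_G be the Jacobiators of the two formal brackets and E(x, y) = Phi [x, y] - [Phi x, Phi y]
   the defect of the formal map Phi. For any skew bilinear m compatible with the twist,
   with no Jacobi identity assumed, J satisfies a formal cocycle identity with respect to m itself,
   and
     cyc ([Phi (alpha x), E(y, z)] + E(alpha x, [y, z])) = Phi J_L(x, y, z) - J_G(Phi x, Phi y, Phi z).
   For a deformation of order N all coefficients of J and E up to N vanish, so the coefficient N + 1
   of these identities only involves the undeformed brackets and the undeformed morphism, and it is
   the cocycle condition for Ob = (- J_L, - J_G, E) at N + 1. The unknown coefficients of order N + 1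
   enter the equations of order N + 1 linearly, precisely through the coboundary. *)

theory Submission
  imports Defs
begin

section \<open>Sums over compositions of a number\<close>

lemma finite_add_eq [simp]:
  fixes n :: nat
  shows "finite {(p, q). p + q = n}" "finite {(i, j, k). i + j + k = n}"
proof -
  show "finite {(p, q). p + q = n}"
    by (rule finite_subset[of _ "{..n} \<times> {..n}"]) auto
  show "finite {(i, j, k). i + j + k = n}"
    by (rule finite_subset[of _ "{..n} \<times> {..n} \<times> {..n}"]) auto
qed

lemma sum_eq_single:
  assumes "finite A" "a \<in> A" "\<And>x. x \<in> A \<Longrightarrow> x \<noteq> a \<Longrightarrow> f x = 0"
  shows "sum f A = f a"
  using assms by (simp add: sum.remove sum.neutral)

text \<open>In a convolution with a sequence that is zero below n, only the leading term survives.
  Read backwards, it replaces an index-0 structure map by the whole formal series at no cost; the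
  identities below rely on this.\<close>

lemma sum_pair_vanishing_below:
  fixes n :: nat
  assumes "\<And>p k. k < n \<Longrightarrow> f p k = 0"
  shows "(\<Sum>(p, k)\<in>{(p, k). p + k = n}. f p k) = f 0 n"
  by (subst sum_eq_single[where a = "(0, n)"]) (auto intro: assms)

lemma sum_triple_vanishing_below:
  fixes n :: nat
  assumes "\<And>p q k. k < n \<Longrightarrow> f p q k = 0"
  shows "(\<Sum>(p, q, k)\<in>{(p, q, k). p + q + k = n}. f p q k) = f 0 0 n"
  by (subst sum_eq_single[where a = "(0, 0, n)"]) (auto intro: assms)

lemma sum_triple_swap13:
  fixes n :: nat
  shows "(\<Sum>(p, q, r)\<in>{(p, q, r). p + q + r = n}. f p q r)
      = (\<Sum>(p, q, r)\<in>{(p, q, r). p + q + r = n}. f r q p)"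
  by (rule sum.reindex_bij_witness[where i = "\<lambda>(p, q, r). (r, q, p)" and j = "\<lambda>(p, q, r). (r, q, p)"])
    auto

lemma sum_triple_swap23:
  fixes n :: nat
  shows "(\<Sum>(p, q, r)\<in>{(p, q, r). p + q + r = n}. f p q r)
      = (\<Sum>(p, q, r)\<in>{(p, q, r). p + q + r = n}. f p r q)"
  by (rule sum.reindex_bij_witness[where i = "\<lambda>(p, q, r). (p, r, q)" and j = "\<lambda>(p, q, r). (p, r, q)"])
    auto

text \<open>Associativity of convolution: merging the split of n into p and s with the split of s
  loses no information, since s = q + r can be recovered.\<close>

lemma sum_pair_pair:
  fixes n :: nat
  shows "(\<Sum>(p, s)\<in>{(p, s). p + s = n}. \<Sum>(q, r)\<in>{(q, r). q + r = s}. f p q r)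
      = (\<Sum>(p, q, r)\<in>{(p, q, r). p + q + r = n}. f p q r)"
proof -
  have "(\<Sum>(p, s)\<in>{(p, s). p + s = n}. \<Sum>(q, r)\<in>{(q, r). q + r = s}. f p q r)
      = (\<Sum>((p, s), (q, r))\<in>(SIGMA u : {(p, s). p + s = n}. {(q, r). q + r = snd u}). f p q r)"
    by (subst sum.Sigma[symmetric]) (auto intro!: sum.cong)
  also have "\<dots> = (\<Sum>(p, q, r)\<in>{(p, q, r). p + q + r = n}. f p q r)"
    by (rule sum.reindex_bij_witness[where i = "\<lambda>(p, q, r). ((p, q + r), (q, r))"
          and j = "\<lambda>((p, s), (q, r)). (p, q, r)"]) auto
  finally show ?thesis .
qed

section \<open>Formal cocycle identities\<close>

text \<open>The coefficient of t^n in the Jacobiator of the formal bracket. In contrast to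
  \<open>Ob_bracket\<close>, the extreme pairs with p = 0 or q = 0 are included.\<close>

definition jacobi_coeff ::
    "('a \<Rightarrow> 'a) \<Rightarrow> (nat \<Rightarrow> 'a \<Rightarrow> 'a \<Rightarrow> 'a) \<Rightarrow> nat \<Rightarrow> 'a \<Rightarrow> 'a \<Rightarrow> 'a \<Rightarrow> 'a::ab_group_add" where
  "jacobi_coeff a m n x y z =
     (\<Sum>(p, q)\<in>{(p, q). p + q = n}. hom_jacobi_sum a (m p) (m q) x y z)"

text \<open>The formal identities are purely additive, so an abelian group suffices here. The
  conditions are imposed at every index p, while a deformation of order N controls only p \<le> N;
  the main proof therefore truncates its families.\<close>

locale skew_family =
  fixes a :: "'a::ab_group_add \<Rightarrow> 'a" and m :: "nat \<Rightarrow> 'a \<Rightarrow> 'a \<Rightarrow> 'a"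
  assumes add_left: "m p (x + y) z = m p x z + m p y z"
    and skew: "m p x y = - m p y x"
    and twist_bracket: "a (m p x y) = m p (a x) (a y)"
begin

lemma add_right: "m p x (y + z) = m p x y + m p x z"
  using add_left skew by (metis add.inverse_distrib_swap add.commute)

lemma additive_left: "additive (\<lambda>x. m p x y)"
  by unfold_locales (rule add_left)

lemma additive_right: "additive (m p x)"
  by unfold_locales (rule add_right)

lemmas zero_right [simp] = additive.zero[OF additive_right]
lemmas zero_left [simp] = additive.zero[OF additive_left]
lemmas minus_right = additive.minus[OF additive_right]
lemmas minus_left = additive.minus[OF additive_left]
lemmas diff_right = additive.diff[OF additive_right]
lemmas sum_right = additive.sum[OF additive_right]

text \<open>The terms \<open>m p (m r _ _) (m q _ _)\<close> cancel only after symmetrising in \<open>q\<close> and \<open>r\<close>; all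
  others cancel within a fixed triple \<open>(p, q, r)\<close>.\<close>

lemma jacobi_coeff_cocycle:
  assumes "\<forall>k<n. \<forall>x y z. jacobi_coeff a m k x y z = 0"
  shows "m 0 (a (a x)) (jacobi_coeff a m n y z w) - m 0 (a (a y)) (jacobi_coeff a m n x z w)
      + m 0 (a (a z)) (jacobi_coeff a m n x y w) - m 0 (a (a w)) (jacobi_coeff a m n x y z)
      - jacobi_coeff a m n (m 0 x y) (a z) (a w) + jacobi_coeff a m n (m 0 x z) (a y) (a w)
      - jacobi_coeff a m n (m 0 x w) (a y) (a z) - jacobi_coeff a m n (m 0 y z) (a x) (a w)
      + jacobi_coeff a m n (m 0 y w) (a x) (a z) - jacobi_coeff a m n (m 0 z w) (a x) (a y) = 0"
proof -
  let ?T = "{(p, q, r). p + q + r = n}"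
  let ?S = "\<lambda>f. \<Sum>(p, q, r)\<in>?T. f p q r"
  \<comment> \<open>Vanishing below n allows \<open>m 0\<close> to become the full series. In
    \<open>outer\<close> and \<open>inner\<close> the names are arranged so that p labels the
    outermost bracket; in a triply nested term q labels the middle one and r the innermost, which
    lets such terms cancel for a fixed triple.\<close>
  have outer: "m 0 u (jacobi_coeff a m n x y z)
      = ?S (\<lambda>p q r. m p u (hom_jacobi_sum a (m r) (m q) x y z))" for u x y z
  proof -
    have "m 0 u (jacobi_coeff a m n x y z)
        = (\<Sum>(p, k)\<in>{(p, k). p + k = n}. m p u (jacobi_coeff a m k x y z))"
      by (rule sum_pair_vanishing_below[symmetric]) (simp_all add: assms)
    also have "\<dots> = (\<Sum>(p, k)\<in>{(p, k). p + k = n}. \<Sum>(q, r)\<in>{(q, r). q + r = k}.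
        m p u (hom_jacobi_sum a (m q) (m r) x y z))"
      by (simp add: jacobi_coeff_def sum_right case_prod_unfold)
    also have "\<dots> = ?S (\<lambda>p q r. m p u (hom_jacobi_sum a (m q) (m r) x y z))"
      by (rule sum_pair_pair)
    also have "\<dots> = ?S (\<lambda>p q r. m p u (hom_jacobi_sum a (m r) (m q) x y z))"
      by (rule sum_triple_swap23)
    finally show ?thesis .
  qed
  have inner: "jacobi_coeff a m n (m 0 x y) u v
      = ?S (\<lambda>p q r. hom_jacobi_sum a (m q) (m p) (m r x y) u v)" for x y u v
  proof -
    have "jacobi_coeff a m n (m 0 x y) u v
        = (\<Sum>(r, k)\<in>{(r, k). r + k = n}. jacobi_coeff a m k (m r x y) u v)"
      by (rule sum_pair_vanishing_below[symmetric]) (simp_all add: assms)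
    also have "\<dots> = ?S (\<lambda>r q p. hom_jacobi_sum a (m q) (m p) (m r x y) u v)"
      unfolding jacobi_coeff_def by (rule sum_pair_pair)
    also have "\<dots> = ?S (\<lambda>p q r. hom_jacobi_sum a (m q) (m p) (m r x y) u v)"
      by (rule sum_triple_swap13)
    finally show ?thesis .
  qed
  \<comment> \<open>\<open>D\<close> holds three of the six products of two brackets, one for each
    splitting of x, y, z, w into two pairs. By skew symmetry of \<open>m p\<close>, the other three
    are the same products with q and r exchanged and the opposite sign.\<close>
  define D where "D p q r = - m p (m r (a x) (a y)) (m q (a z) (a w))
      + m p (m r (a x) (a z)) (m q (a y) (a w)) - m p (m r (a x) (a w)) (m q (a y) (a z))" for p q r
  have "m p (a (a x)) (hom_jacobi_sum a (m r) (m q) y z w)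
      - m p (a (a y)) (hom_jacobi_sum a (m r) (m q) x z w)
      + m p (a (a z)) (hom_jacobi_sum a (m r) (m q) x y w)
      - m p (a (a w)) (hom_jacobi_sum a (m r) (m q) x y z)
      - hom_jacobi_sum a (m q) (m p) (m r x y) (a z) (a w)
      + hom_jacobi_sum a (m q) (m p) (m r x z) (a y) (a w)
      - hom_jacobi_sum a (m q) (m p) (m r x w) (a y) (a z)
      - hom_jacobi_sum a (m q) (m p) (m r y z) (a x) (a w)
      + hom_jacobi_sum a (m q) (m p) (m r y w) (a x) (a z)
      - hom_jacobi_sum a (m q) (m p) (m r z w) (a x) (a y) = D p q r - D p r q" (is "?I p q r = _") for p q r
  proof -
    \<comment> \<open>Skew symmetry is oriented into a normal form: \<open>swap\<close> moves a
      nested bracket to the right, \<open>ord\<close> sorts the innermost arguments as x, y, z, w,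
      and \<open>cross\<close> puts the factor containing \<open>a x\<close> first.\<close>
    have swap: "m q (m r u v) t = - m q t (m r u v)" for u v t
      by (rule skew)
    note ord = skew[of r w x] skew[of r w y] skew[of r w z] skew[of r z x] skew[of r z y] skew[of r y x]
    note cross = skew[of p "m r (a y) (a z)" "m q (a x) (a w)"]
      skew[of p "m r (a y) (a w)" "m q (a x) (a z)"]
      skew[of p "m r (a z) (a w)" "m q (a x) (a y)"]
    show ?thesis
      by (simp add: D_def hom_jacobi_sum_def twist_bracket add_right minus_right diff_right swap ord cross algebra_simps)
  qed
  then have "?S ?I = ?S (\<lambda>p q r. D p q r) - ?S (\<lambda>p q r. D p r q)"
    by (simp add: sum_subtractf case_prod_unfold)
  also have "\<dots> = 0"
    by (subst sum_triple_swap23) simp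
  finally show ?thesis
    unfolding outer inner by (simp add: sum_subtractf sum.distrib case_prod_unfold)
qed

end

section \<open>The defect of the formal morphism and its cocycle identity\<close>

definition morphism_defect ::
    "(nat \<Rightarrow> 'a \<Rightarrow> 'a \<Rightarrow> 'a) \<Rightarrow> (nat \<Rightarrow> 'b \<Rightarrow> 'b \<Rightarrow> 'b) \<Rightarrow> (nat \<Rightarrow> 'a \<Rightarrow> 'b)
      \<Rightarrow> nat \<Rightarrow> 'a \<Rightarrow> 'a \<Rightarrow> 'b::ab_group_add" where
  "morphism_defect mL mG ph n x y = (\<Sum>i\<in>{0..n}. ph i (mL (n - i) x y))
     - (\<Sum>(i, j, k)\<in>{(i, j, k). i + j + k = n}. mG k (ph i x) (ph j y))"

locale skew_family_pair =
  L: skew_family a mL + G: skew_family b mG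
  for a :: "'a::ab_group_add \<Rightarrow> 'a" and mL :: "nat \<Rightarrow> 'a \<Rightarrow> 'a \<Rightarrow> 'a"
    and b :: "'b::ab_group_add \<Rightarrow> 'b" and mG :: "nat \<Rightarrow> 'b \<Rightarrow> 'b \<Rightarrow> 'b" +
  fixes ph :: "nat \<Rightarrow> 'a \<Rightarrow> 'b"
  assumes ph_add: "ph i (x + y) = ph i x + ph i y"
    and ph_twist: "ph i (a x) = b (ph i x)"
begin

abbreviation "E \<equiv> morphism_defect mL mG ph"

lemma additive_ph: "additive (ph i)"
  by unfold_locales (rule ph_add)

lemmas ph_zero [simp] = additive.zero[OF additive_ph]
lemmas ph_minus = additive.minus[OF additive_ph]
lemmas ph_sum = additive.sum[OF additive_ph]

lemma image_part_conv: "(\<Sum>i\<in>{0..n}. ph i (mL (n - i) x y))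
    = (\<Sum>(i, k)\<in>{(i, k). i + k = n}. ph i (mL k x y))"
  by (rule sum.reindex_bij_witness[where i = fst and j = "\<lambda>i. (i, n - i)"]) auto

lemma morphism_defect_skew: "E n y x = - E n x y"
proof -
  have "(\<Sum>(i, j, k)\<in>{(i, j, k). i + j + k = n}. mG k (ph i y) (ph j x))
      = (\<Sum>(i, j, k)\<in>{(i, j, k). i + j + k = n}. - mG k (ph i x) (ph j y))"
    by (rule sum.reindex_bij_witness[where i = "\<lambda>(i, j, k). (j, i, k)" and j = "\<lambda>(i, j, k). (j, i, k)"])
      (auto simp flip: G.skew)
  moreover have "(\<Sum>i\<in>{0..n}. ph i (mL (n - i) y x)) = (\<Sum>i\<in>{0..n}. - ph i (mL (n - i) x y))"
    by (simp flip: L.skew ph_minus)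
  ultimately show ?thesis
    by (simp add: morphism_defect_def sum_negf case_prod_unfold)
qed

lemma morphism_defect_minus_left: "E n (- x) y = - E n x y"
  by (simp add: morphism_defect_def L.minus_left G.minus_left ph_minus sum_negf case_prod_unfold)

text \<open>Rewrite \<open>[\<phi> y, \<phi> z]\<close> and then \<open>[\<phi> (a x), \<phi> [y, z]]\<close> by means of the defect.\<close>

lemma nested_image_bracket:
  assumes "\<forall>k<n. \<forall>x y. E k x y = 0"
  shows "(\<Sum>(i, q, s)\<in>{(i, q, s). i + q + s = n}. mG q (ph i (a x))
        (\<Sum>(j, k, p)\<in>{(j, k, p). j + k + p = s}. mG p (ph j y) (ph k z)))
      = (\<Sum>(c, e)\<in>{(c, e). c + e = n}. ph c (\<Sum>(p, q)\<in>{(p, q). p + q = e}. mL q (a x) (mL p y z)))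
        - E n (a x) (mL 0 y z) - mG 0 (ph 0 (a x)) (E n y z)"
proof -
  \<comment> \<open>\<open>P\<close> and \<open>Q\<close> are the coefficients of Phi [x, y] and
    [Phi x, Phi y], so the defect is their difference. Exchanging \<open>Q\<close> for
    \<open>P\<close> twice moves both brackets from G to L and leaves one defect term each
    time.\<close>
  define P where "P s x y = (\<Sum>(i, k)\<in>{(i, k). i + k = s}. ph i (mL k x y))" for s x y
  define Q where "Q s x y = (\<Sum>(i, j, k)\<in>{(i, j, k). i + j + k = s}. mG k (ph i x) (ph j y))" for s x y
  have Q: "Q s x y = P s x y - E s x y" for s x y
    by (simp add: P_def Q_def morphism_defect_def image_part_conv)
  have "(\<Sum>(i, q, s)\<in>{(i, q, s). i + q + s = n}. mG q (ph i (a x)) (Q s y z))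
      = (\<Sum>(i, q, s)\<in>{(i, q, s). i + q + s = n}. mG q (ph i (a x)) (P s y z))
        - (\<Sum>(i, q, s)\<in>{(i, q, s). i + q + s = n}. mG q (ph i (a x)) (E s y z))"
    by (simp add: Q G.diff_right sum_subtractf case_prod_unfold)
  also have "(\<Sum>(i, q, s)\<in>{(i, q, s). i + q + s = n}. mG q (ph i (a x)) (E s y z))
      = mG 0 (ph 0 (a x)) (E n y z)"
    by (rule sum_triple_vanishing_below) (simp add: assms)
  \<comment> \<open>Regrouping for the second exchange: the index p of the inner L-bracket is split
    off, and the remaining indices i, c, q form a coefficient \<open>Q\<close> with second argument
    \<open>mL p y z\<close>.\<close>
  also have "(\<Sum>(i, q, s)\<in>{(i, q, s). i + q + s = n}. mG q (ph i (a x)) (P s y z))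
      = (\<Sum>(p, s)\<in>{(p, s). p + s = n}. Q s (a x) (mL p y z))"
  proof -
    have "(\<Sum>(i, q, s)\<in>{(i, q, s). i + q + s = n}. mG q (ph i (a x)) (P s y z))
        = (\<Sum>(u, (c, p))\<in>(SIGMA u : {(i, q, s). i + q + s = n}. {(c, p). c + p = snd (snd u)}).
            mG (fst (snd u)) (ph (fst u) (a x)) (ph c (mL p y z)))"
      by (subst sum.Sigma[symmetric]) (auto simp: P_def G.sum_right intro!: sum.cong)
    also have "\<dots> = (\<Sum>(u, (i, c, q))\<in>(SIGMA u : {(p, s). p + s = n}. {(i, c, q). i + c + q = snd u}).
            mG q (ph i (a x)) (ph c (mL (fst u) y z)))"
      by (rule sum.reindex_bij_witness[where i = "\<lambda>((p, s), (i, c, q)). ((i, q, c + p), (c, p))"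
            and j = "\<lambda>((i, q, s), (c, p)). ((p, i + c + q), (i, c, q))"]) auto
    also have "\<dots> = (\<Sum>(p, s)\<in>{(p, s). p + s = n}. Q s (a x) (mL p y z))"
      by (subst sum.Sigma[symmetric]) (auto simp: Q_def intro!: sum.cong)
    finally show ?thesis .
  qed
  also have "\<dots> = (\<Sum>(p, s)\<in>{(p, s). p + s = n}. P s (a x) (mL p y z))
      - (\<Sum>(p, s)\<in>{(p, s). p + s = n}. E s (a x) (mL p y z))"
    by (simp add: Q sum_subtractf case_prod_unfold)
  also have "(\<Sum>(p, s)\<in>{(p, s). p + s = n}. E s (a x) (mL p y z)) = E n (a x) (mL 0 y z)"
    by (rule sum_pair_vanishing_below) (simp add: assms)
  also have "(\<Sum>(p, s)\<in>{(p, s). p + s = n}. P s (a x) (mL p y z))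
      = (\<Sum>(p, c, q)\<in>{(p, c, q). p + c + q = n}. ph c (mL q (a x) (mL p y z)))"
    unfolding P_def by (rule sum_pair_pair)
  also have "\<dots> = (\<Sum>(c, p, q)\<in>{(c, p, q). c + p + q = n}. ph c (mL q (a x) (mL p y z)))"
    by (rule sum.reindex_bij_witness[where i = "\<lambda>(i, j, k). (j, i, k)" and j = "\<lambda>(i, j, k). (j, i, k)"])
      auto
  also have "\<dots> = (\<Sum>(c, e)\<in>{(c, e). c + e = n}. \<Sum>(p, q)\<in>{(p, q). p + q = e}. ph c (mL q (a x) (mL p y z)))"
    by (rule sum_pair_pair[symmetric])
  finally show ?thesis
    by (simp add: Q_def ph_sum case_prod_unfold)
qed

text \<open>As the Jacobiator on G vanishes below n, each argument \<open>ph 0 x\<close> may be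
  replaced by the full series Phi x. Splitting the Jacobiator index into p and q and regrouping then
  gives the nested brackets handled by \<open>nested_image_bracket\<close>, one for each cyclic
  rotation.\<close>

lemma jacobi_coeff_image:
  assumes "\<forall>k<n. \<forall>x y z. jacobi_coeff b mG k x y z = 0"
  shows "jacobi_coeff b mG n (ph 0 x) (ph 0 y) (ph 0 z) =
    (\<Sum>(i, q, s)\<in>{(i, q, s). i + q + s = n}. mG q (ph i (a x))
        (\<Sum>(j, k, p)\<in>{(j, k, p). j + k + p = s}. mG p (ph j y) (ph k z)))
    + (\<Sum>(i, q, s)\<in>{(i, q, s). i + q + s = n}. mG q (ph i (a y))
        (\<Sum>(j, k, p)\<in>{(j, k, p). j + k + p = s}. mG p (ph j z) (ph k x)))
    + (\<Sum>(i, q, s)\<in>{(i, q, s). i + q + s = n}. mG q (ph i (a z))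
        (\<Sum>(j, k, p)\<in>{(j, k, p). j + k + p = s}. mG p (ph j x) (ph k y)))" (is "_ = ?R")
proof -
  let ?A = "{(i, j, k, s). i + j + k + s = n}"
  let ?U = "SIGMA u : {(i, j, k, s). i + j + k + s = n}. {(p, q). p + q = snd (snd (snd u))}"
  have fin: "finite ?A"
    by (rule finite_subset[of _ "{..n} \<times> {..n} \<times> {..n} \<times> {..n}"]) auto
  have flat: "(\<Sum>(i, q, s)\<in>{(i, q, s). i + q + s = n}. mG q (ph i (a x))
        (\<Sum>(j, k, p)\<in>{(j, k, p). j + k + p = s}. mG p (ph j y) (ph k z)))
      = (\<Sum>((i, q, s), (j, k, p))\<in>(SIGMA u : {(i, q, s). i + q + s = n}. {(j, k, p). j + k + p = snd (snd u)}).
          mG q (ph i (a x)) (mG p (ph j y) (ph k z)))" for x y z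
    by (subst sum.Sigma[symmetric]) (auto simp: G.sum_right intro!: sum.cong)
  have "jacobi_coeff b mG n (ph 0 x) (ph 0 y) (ph 0 z)
      = (\<Sum>(i, j, k, s)\<in>?A. jacobi_coeff b mG s (ph i x) (ph j y) (ph k z))"
  proof -
    have "(case u of (i, j, k, s) \<Rightarrow> jacobi_coeff b mG s (ph i x) (ph j y) (ph k z)) = 0"
      if "u \<in> ?A" "u \<noteq> (0, 0, 0, n)" for u
      using that by (cases u) (auto simp: assms)
    then show ?thesis
      by (subst sum_eq_single[of ?A "(0, 0, 0, n)", OF fin]) simp_all
  qed
  also have "\<dots> = (\<Sum>((i, j, k, s), (p, q))\<in>?U. hom_jacobi_sum b (mG p) (mG q) (ph i x) (ph j y) (ph k z))"
    using fin by (subst sum.Sigma[symmetric]) (auto simp: jacobi_coeff_def intro!: sum.cong)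
  also have "\<dots> = (\<Sum>((i, j, k, s), (p, q))\<in>?U. mG q (ph i (a x)) (mG p (ph j y) (ph k z)))
      + (\<Sum>((i, j, k, s), (p, q))\<in>?U. mG q (ph j (a y)) (mG p (ph k z) (ph i x)))
      + (\<Sum>((i, j, k, s), (p, q))\<in>?U. mG q (ph k (a z)) (mG p (ph i x) (ph j y)))"
    by (simp add: hom_jacobi_sum_def ph_twist sum.distrib case_prod_unfold)
  also have "(\<Sum>((i, j, k, s), (p, q))\<in>?U. mG q (ph i (a x)) (mG p (ph j y) (ph k z)))
      = (\<Sum>(i, q, s)\<in>{(i, q, s). i + q + s = n}. mG q (ph i (a x))
        (\<Sum>(j, k, p)\<in>{(j, k, p). j + k + p = s}. mG p (ph j y) (ph k z)))"
    unfolding flat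
    by (rule sum.reindex_bij_witness[where i = "\<lambda>((i, q, s), (j, k, p)). ((i, j, k, p + q), (p, q))"
            and j = "\<lambda>((i, j, k, s), (p, q)). ((i, q, j + k + p), (j, k, p))"]) auto
  also have "(\<Sum>((i, j, k, s), (p, q))\<in>?U. mG q (ph j (a y)) (mG p (ph k z) (ph i x)))
      = (\<Sum>(i, q, s)\<in>{(i, q, s). i + q + s = n}. mG q (ph i (a y))
        (\<Sum>(j, k, p)\<in>{(j, k, p). j + k + p = s}. mG p (ph j z) (ph k x)))"
    unfolding flat
    by (rule sum.reindex_bij_witness[where i = "\<lambda>((j, q, s), (k, i, p)). ((i, j, k, p + q), (p, q))"
            and j = "\<lambda>((i, j, k, s), (p, q)). ((j, q, k + i + p), (k, i, p))"]) auto
  also have "(\<Sum>((i, j, k, s), (p, q))\<in>?U. mG q (ph k (a z)) (mG p (ph i x) (ph j y)))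
      = (\<Sum>(i, q, s)\<in>{(i, q, s). i + q + s = n}. mG q (ph i (a z))
        (\<Sum>(j, k, p)\<in>{(j, k, p). j + k + p = s}. mG p (ph j x) (ph k y)))"
    unfolding flat
    by (rule sum.reindex_bij_witness[where i = "\<lambda>((k, q, s), (i, j, p)). ((i, j, k, p + q), (p, q))"
            and j = "\<lambda>((i, j, k, s), (p, q)). ((k, q, i + j + p), (i, j, p))"]) auto
  finally show ?thesis .
qed

text \<open>The cyclic sum of \<open>nested_image_bracket\<close>: its G-side is the Jacobiator on
  the images by \<open>jacobi_coeff_image\<close>, and its iterated L-brackets add up to the image
  of the Jacobiator on L. The defect terms are arranged as in the degree-two coboundary.\<close>

lemma morphism_defect_cocycle:
  assumes E: "\<forall>k<n. \<forall>x y. E k x y = 0"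
    and JL: "\<forall>k<n. \<forall>x y z. jacobi_coeff a mL k x y z = 0"
    and JG: "\<forall>k<n. \<forall>x y z. jacobi_coeff b mG k x y z = 0"
  shows "mG 0 (ph 0 (a x)) (E n y z) - mG 0 (ph 0 (a y)) (E n x z) + mG 0 (ph 0 (a z)) (E n x y)
      - E n (mL 0 x y) (a z) + E n (mL 0 x z) (a y) - E n (mL 0 y z) (a x)
      = ph 0 (jacobi_coeff a mL n x y z) - jacobi_coeff b mG n (ph 0 x) (ph 0 y) (ph 0 z)"
proof -
  have "ph 0 (jacobi_coeff a mL n x y z)
      = (\<Sum>(c, e)\<in>{(c, e). c + e = n}. ph c (jacobi_coeff a mL e x y z))"
    by (rule sum_pair_vanishing_below[symmetric]) (simp add: JL)
  also have "\<dots> =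
      (\<Sum>(c, e)\<in>{(c, e). c + e = n}. ph c (\<Sum>(p, q)\<in>{(p, q). p + q = e}. mL q (a x) (mL p y z)))
      + (\<Sum>(c, e)\<in>{(c, e). c + e = n}. ph c (\<Sum>(p, q)\<in>{(p, q). p + q = e}. mL q (a y) (mL p z x)))
      + (\<Sum>(c, e)\<in>{(c, e). c + e = n}. ph c (\<Sum>(p, q)\<in>{(p, q). p + q = e}. mL q (a z) (mL p x y)))"
    by (simp add: jacobi_coeff_def hom_jacobi_sum_def sum.distrib ph_add case_prod_unfold)
  finally have "ph 0 (jacobi_coeff a mL n x y z) - jacobi_coeff b mG n (ph 0 x) (ph 0 y) (ph 0 z)
      = E n (a x) (mL 0 y z) + mG 0 (ph 0 (a x)) (E n y z)
        + (E n (a y) (mL 0 z x) + mG 0 (ph 0 (a y)) (E n z x))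
        + (E n (a z) (mL 0 x y) + mG 0 (ph 0 (a z)) (E n x y))"
    by (simp add: jacobi_coeff_image[OF JG] nested_image_bracket[OF E])
  \<comment> \<open>Two signs cancel here, one from reversing z and x and one from exchanging the
    arguments of the defect.\<close>
  moreover have "E n (a y) (mL 0 z x) = E n (mL 0 x z) (a y)"
    by (simp add: L.skew[of 0 z x] morphism_defect_skew[of n "a y"] morphism_defect_minus_left)
  ultimately show ?thesis
    by (simp add: morphism_defect_skew[of n "a x" "mL 0 y z"] morphism_defect_skew[of n "a z" "mL 0 x y"]
        morphism_defect_skew[of n z x] G.minus_right)
qed

end

section \<open>Cochains of low degree\<close>

lemma linear_sum_fun:
  assumes "vector_space s1" "vector_space s2"
    and "\<And>i. i \<in> I \<Longrightarrow> Vector_Spaces.linear s1 s2 (f i)"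
  shows "Vector_Spaces.linear s1 s2 (\<lambda>x. \<Sum>i\<in>I. f i x)"
proof -
  interpret vector_space_pair s1 s2
    using assms by (simp add: vector_space_pair_def)
  show ?thesis
    using assms(3) by (cases "finite I") (auto intro: linear_compose_sum linear_zero)
qed

lemma linear_add_fun:
  "Vector_Spaces.linear s1 s2 f \<Longrightarrow> Vector_Spaces.linear s1 s2 g \<Longrightarrow>
    Vector_Spaces.linear s1 s2 (\<lambda>x. f x + g x)"
  by (simp add: Vector_Spaces.linear_iff vector_space.vector_space_assms add_ac)

lemma linear_minus_fun:
  "Vector_Spaces.linear s1 s2 f \<Longrightarrow> Vector_Spaces.linear s1 s2 (\<lambda>x. - f x)"
  using vector_space_pair.linear_compose_neg[of s1 s2 f]
  by (simp add: vector_space_pair_def Vector_Spaces.linear_def)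

lemma linear_diff_fun:
  "Vector_Spaces.linear s1 s2 f \<Longrightarrow> Vector_Spaces.linear s1 s2 g \<Longrightarrow>
    Vector_Spaces.linear s1 s2 (\<lambda>x. f x - g x)"
  using linear_add_fun[OF _ linear_minus_fun, of s1 s2 f g] by simp

lemma linear_comp_fun:
  "Vector_Spaces.linear s2 s3 g \<Longrightarrow> Vector_Spaces.linear s1 s2 f \<Longrightarrow>
    Vector_Spaces.linear s1 s3 (\<lambda>x. g (f x))"
  by (simp add: Vector_Spaces.linear_iff)

lemma length_eq_2_iff: "length xs = 2 \<longleftrightarrow> (\<exists>x y. xs = [x, y])"
  and length_eq_3_iff: "length xs = 3 \<longleftrightarrow> (\<exists>x y z. xs = [x, y, z])"
  and length_eq_4_iff: "length xs = 4 \<longleftrightarrow> (\<exists>x y z w. xs = [x, y, z, w])"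
  by (auto simp: length_Suc_conv eval_nat_numeral)

section \<open>Cochains of degree one to three as maps of one to three variables\<close>

lemma cochain1_in_cochains_iff:
  "cochain1 f \<in> cochains L G 1 \<longleftrightarrow>
    Vector_Spaces.linear (smul L) (smul G) f \<and> (\<forall>x. twist G (f x) = f (twist L x))"
proof
  assume *: "cochain1 f \<in> cochains L G 1"
  then have "\<And>xs i. length xs = 1 \<Longrightarrow> i < 1 \<Longrightarrow>
      Vector_Spaces.linear (smul L) (smul G) (\<lambda>v. cochain1 f (xs[i := v]))"
    and tw: "\<And>xs. length xs = 1 \<Longrightarrow> twist G (cochain1 f xs) = cochain1 f (map (twist L) xs)"
    by (simp_all add: cochains_def)
  \<comment> \<open>The list update overwrites the tested slot, so its initial entry is
    arbitrary.\<close>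
  from this(1)[of "[undefined]" 0] tw[of "[_]"]
  show "Vector_Spaces.linear (smul L) (smul G) f \<and> (\<forall>x. twist G (f x) = f (twist L x))"
    by (simp add: cochain1_def)
next
  assume *: "Vector_Spaces.linear (smul L) (smul G) f \<and> (\<forall>x. twist G (f x) = f (twist L x))"
  then show "cochain1 f \<in> cochains L G 1"
    by (auto simp: cochains_def cochain1_def length_Suc_conv split: list.split)
qed

lemma cochain2_in_cochainsD:
  assumes "cochain2 f \<in> cochains L G 2"
  shows "Vector_Spaces.linear (smul L) (smul G) (\<lambda>x. f x y)"
    and "Vector_Spaces.linear (smul L) (smul G) (f x)"
    and "f x y = - f y x"
    and "twist G (f x y) = f (twist L x) (twist L y)"
proof -
  have lin: "\<And>xs i. length xs = 2 \<Longrightarrow> i < 2 \<Longrightarrow>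
      Vector_Spaces.linear (smul L) (smul G) (\<lambda>v. cochain2 f (xs[i := v]))"
    and sk: "\<And>xs i j. length xs = 2 \<Longrightarrow> i < j \<Longrightarrow> j < 2 \<Longrightarrow>
      cochain2 f (xs[i := xs ! j, j := xs ! i]) = - cochain2 f xs"
    and tw: "\<And>xs. length xs = 2 \<Longrightarrow> twist G (cochain2 f xs) = cochain2 f (map (twist L) xs)"
    using assms by (simp_all add: cochains_def)
  show "Vector_Spaces.linear (smul L) (smul G) (\<lambda>x. f x y)"
    using lin[of "[undefined, y]" 0] by (simp add: cochain2_def)
  show "Vector_Spaces.linear (smul L) (smul G) (f x)"
    using lin[of "[x, undefined]" 1] by (simp add: cochain2_def)
  show "f x y = - f y x"
    using sk[of "[y, x]" 0 1] by (simp add: cochain2_def)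
  show "twist G (f x y) = f (twist L x) (twist L y)"
    using tw[of "[x, y]"] by (simp add: cochain2_def)
qed

lemma cochain2_in_cochainsI:
  assumes lin: "\<And>y. Vector_Spaces.linear (smul L) (smul G) (\<lambda>x. f x y)"
    and skew: "\<And>x y. f y x = - f x y"
    and twist: "\<And>x y. twist G (f x y) = f (twist L x) (twist L y)"
  shows "cochain2 f \<in> cochains L G 2"
proof -
  have lin2: "Vector_Spaces.linear (smul L) (smul G) (\<lambda>y. f x y)" for x
    using linear_minus_fun[OF lin[of x]] by (simp flip: skew)
  show ?thesis
    by (auto simp: cochains_def cochain2_def length_eq_2_iff less_2_cases_iff lin lin2 twist
        split: list.split intro: skew)
qed

text \<open>The adjacent transpositions generate all permutations of three arguments: the exchange
  of x and z is a product of three of them, hence also has sign -1. They also carry linearity from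
  the first slot to the other two.\<close>

lemma cochain3_in_cochainsI:
  assumes lin: "\<And>y z. Vector_Spaces.linear (smul L) (smul G) (\<lambda>x. f x y z)"
    and skew12: "\<And>x y z. f y x z = - f x y z"
    and skew23: "\<And>x y z. f x z y = - f x y z"
    and twist: "\<And>x y z. twist G (f x y z) = f (twist L x) (twist L y) (twist L z)"
  shows "cochain3 f \<in> cochains L G 3"
proof -
  have lin2: "Vector_Spaces.linear (smul L) (smul G) (\<lambda>y. f x y z)" for x z
    using linear_minus_fun[OF lin[of x z]] by (simp flip: skew12)
  have lin3: "Vector_Spaces.linear (smul L) (smul G) (\<lambda>z. f x y z)" for x y
    using linear_minus_fun[OF lin2[of x y]] by (simp flip: skew23)
  have skew13: "f z y x = - f x y z" for x y z
    using skew12[of z y x] skew23[of y z x] skew12[of x y z] by simp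
  have less3: "i < 3 \<longleftrightarrow> i = 0 \<or> i = 1 \<or> i = 2" for i :: nat
    by auto
  have "cochain3 f (xs[i := xs ! j, j := xs ! i]) = - cochain3 f xs"
    if "length xs = 3" "i < j" "j < 3" for xs i j
  proof -
    from that consider "i = 0" "j = 1" | "i = 0" "j = 2" | "i = 1" "j = 2"
      by linarith
    then show ?thesis
      using that(1)
      by cases (auto simp: cochain3_def length_eq_3_iff numeral_2_eq_2 intro: skew12 skew23 skew13)
  qed
  moreover have "Vector_Spaces.linear (smul L) (smul G) (\<lambda>v. cochain3 f (xs[i := v]))"
    if "length xs = 3" "i < 3" for xs i
    using that lin lin2 lin3
    by (auto simp: cochain3_def length_eq_3_iff less3 numeral_2_eq_2)
  ultimately show ?thesis
    by (auto simp: cochains_def) (auto simp: cochain3_def length_eq_3_iff twist split: list.split)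
qed

text \<open>Cochains are zero off their degree, so each one comes from a curried map. This and its
  degree-two analogue connect coboundaries, which range over functions on lists, with extensions,
  which range over curried maps.\<close>

lemma cochains_1_eq_cochain1: "f \<in> cochains L G 1 \<Longrightarrow> f = cochain1 (\<lambda>x. f [x])"
  by (auto simp: cochains_def cochain1_def fun_eq_iff split: list.split)

lemma cochains_2_eq_cochain2: "f \<in> cochains L G 2 \<Longrightarrow> f = cochain2 (\<lambda>x y. f [x, y])"
  by (auto simp: cochains_def cochain2_def fun_eq_iff split: list.split)

lemma cochain2_eq_iff: "cochain2 f = cochain2 g \<longleftrightarrow> (\<forall>x y. f x y = g x y)"
proof
  assume "cochain2 f = cochain2 g"
  then have "cochain2 f [x, y] = cochain2 g [x, y]" for x y
    by simp
  then show "\<forall>x y. f x y = g x y"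
    by (simp add: cochain2_def)
qed (metis ext)

lemma cochain3_eq_iff: "cochain3 f = cochain3 g \<longleftrightarrow> (\<forall>x y z. f x y z = g x y z)"
proof
  assume "cochain3 f = cochain3 g"
  then have "cochain3 f [x, y, z] = cochain3 g [x, y, z]" for x y z
    by simp
  then show "\<forall>x y z. f x y z = g x y z"
    by (simp add: cochain3_def)
qed (metis ext)

section \<open>The coboundary operator written out in degrees one, two and three\<close>

lemma delta_HL_cochain1:
  assumes "vector_space (smul G)"
  shows "delta_HL L G \<phi> 1 (cochain1 f)
    = cochain2 (\<lambda>x y. bracket G (\<phi> x) (f y) - bracket G (\<phi> y) (f x) - f (bracket L x y))"
proof -
  interpret vector_space "smul G" by fact
  have pairs: "{(i, j). i < j \<and> j \<le> Suc 0} = {(0, Suc 0)}"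
    by auto
  have "delta_HL L G \<phi> 1 (cochain1 f) xs
      = cochain2 (\<lambda>x y. bracket G (\<phi> x) (f y) - bracket G (\<phi> y) (f x) - f (bracket L x y)) xs" for xs
  proof (cases "length xs = 2")
    case True
    then obtain x y where "xs = [x, y]"
      by (auto simp: length_eq_2_iff)
    then show ?thesis
      by (simp add: delta_HL_def pairs cochain1_def cochain2_def nths_Cons)
  qed (auto simp: delta_HL_def cochain2_def split: list.split)
  then show ?thesis ..
qed

lemma delta_HL_cochain2:
  assumes "vector_space (smul G)"
  shows "delta_HL L G \<phi> 2 (cochain2 f) = cochain3 (\<lambda>x y z.
      bracket G (\<phi> (twist L x)) (f y z) - bracket G (\<phi> (twist L y)) (f x z)
      + bracket G (\<phi> (twist L z)) (f x y)
      - f (bracket L x y) (twist L z) + f (bracket L x z) (twist L y) - f (bracket L y z) (twist L x))"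
    (is "_ = cochain3 ?h")
proof -
  interpret vector_space "smul G" by fact
  have pairs: "{(i, j). i < j \<and> j \<le> Suc (Suc 0)} = {(0, Suc 0), (0, Suc (Suc 0)), (Suc 0, Suc (Suc 0))}"
    by auto
  have "delta_HL L G \<phi> 2 (cochain2 f) xs = cochain3 ?h xs" for xs
  proof (cases "length xs = 3")
    case True
    then obtain x y z where "xs = [x, y, z]"
      by (auto simp: length_eq_3_iff)
    then show ?thesis
      by (simp add: delta_HL_def pairs cochain2_def cochain3_def nths_Cons numeral_2_eq_2)
  qed (auto simp: delta_HL_def cochain3_def split: list.split)
  then show ?thesis ..
qed

text \<open>The ten terms come in the order and with the signs of
  \<open>jacobi_coeff_cocycle\<close>, so that identity applies by rewriting.\<close>

lemma delta_HL_cochain3: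
  assumes "vector_space (smul G)"
  shows "delta_HL L G \<phi> 3 (cochain3 f) xs = (case xs of [x, y, z, w] \<Rightarrow>
      bracket G (\<phi> (twist L (twist L x))) (f y z w) - bracket G (\<phi> (twist L (twist L y))) (f x z w)
      + bracket G (\<phi> (twist L (twist L z))) (f x y w) - bracket G (\<phi> (twist L (twist L w))) (f x y z)
      - f (bracket L x y) (twist L z) (twist L w) + f (bracket L x z) (twist L y) (twist L w)
      - f (bracket L x w) (twist L y) (twist L z) - f (bracket L y z) (twist L x) (twist L w)
      + f (bracket L y w) (twist L x) (twist L z) - f (bracket L z w) (twist L x) (twist L y)
    | _ \<Rightarrow> 0)"
proof -
  interpret vector_space "smul G" by fact
  have pairs: "{(i, j). i < j \<and> j \<le> Suc (Suc (Suc 0))} = {(0, Suc 0), (0, Suc (Suc 0)),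
      (0, Suc (Suc (Suc 0))), (Suc 0, Suc (Suc 0)), (Suc 0, Suc (Suc (Suc 0))),
      (Suc (Suc 0), Suc (Suc (Suc 0)))}"
    by auto
  show ?thesis
  proof (cases "length xs = 4")
    case True
    then obtain x y z w where "xs = [x, y, z, w]"
      by (auto simp: length_eq_4_iff)
    then show ?thesis
      by (simp add: delta_HL_def pairs cochain3_def nths_Cons numeral_3_eq_3 numeral_2_eq_2)
  qed (auto simp: delta_HL_def split: list.split)
qed

section \<open>The obstruction components as cochains, and the cocycle identity on lists\<close>

lemma skew_family_cochains:
  assumes "\<And>p. cochain2 (m p) \<in> cochains L L 2"
  shows "skew_family (twist L) m"
proof
  fix p x y z
  interpret lin: Vector_Spaces.linear "smul L" "smul L" "\<lambda>x. m p x z"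
    by (rule cochain2_in_cochainsD(1)[OF assms])
  show "m p (x + y) z = m p x z + m p y z"
    by (rule lin.add)
qed (rule cochain2_in_cochainsD(3)[OF assms], rule cochain2_in_cochainsD(4)[OF assms])

lemma skew_family_pair_cochains:
  assumes mL: "\<And>p. cochain2 (mL p) \<in> cochains L L 2" and mG: "\<And>p. cochain2 (mG p) \<in> cochains G G 2"
    and ph: "\<And>i. cochain1 (ph i) \<in> cochains L G 1"
  shows "skew_family_pair (twist L) mL (twist G) mG ph"
proof (intro skew_family_pair.intro skew_family_cochains mL mG skew_family_pair_axioms.intro)
  show "ph i (x + y) = ph i x + ph i y" "ph i (twist L x) = twist G (ph i x)" for i x y
    using ph[of i] by (simp_all only: cochain1_in_cochains_iff Vector_Spaces.linear_iff)
qed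

text \<open>For each pair (p, q), a transposition of two arguments permutes the three cyclic terms
  and reverses every inner bracket, so the cyclic sum changes sign.\<close>

lemma Ob_bracket_in_cochains:
  assumes m: "\<And>p. cochain2 (m p) \<in> cochains L L 2"
    and tw: "Vector_Spaces.linear (smul L) (smul L) (twist L)"
  shows "cochain3 (Ob_bracket (twist L) N m) \<in> cochains L L 3"
proof -
  interpret skew_family "twist L" m
    using m by (rule skew_family_cochains)
  interpret tw: Vector_Spaces.linear "smul L" "smul L" "twist L"
    by (rule tw)
  note lin = cochain2_in_cochainsD(1,2)[OF m]
  have vs: "vector_space (smul L)" ..
  show ?thesis
  proof (rule cochain3_in_cochainsI)
    fix x y z
    show "Vector_Spaces.linear (smul L) (smul L) (\<lambda>x. Ob_bracket (twist L) N m x y z)"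
      unfolding Ob_bracket_def hom_jacobi_sum_def case_prod_unfold
      by (intro linear_minus_fun linear_sum_fun vs linear_add_fun linear_comp_fun[OF lin(1) tw] lin
          linear_comp_fun[OF lin(2) lin(1)] linear_comp_fun[OF lin(2) lin(2)])
    show "Ob_bracket (twist L) N m y x z = - Ob_bracket (twist L) N m x y z"
      by (simp add: Ob_bracket_def hom_jacobi_sum_def skew[of _ y x] skew[of _ z x] skew[of _ z y]
          minus_right case_prod_unfold algebra_simps flip: sum_negf)
    show "Ob_bracket (twist L) N m x z y = - Ob_bracket (twist L) N m x y z"
      by (simp add: Ob_bracket_def hom_jacobi_sum_def skew[of _ y x] skew[of _ z x] skew[of _ z y]
          minus_right case_prod_unfold algebra_simps flip: sum_negf)
    show "twist L (Ob_bracket (twist L) N m x y z)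
        = Ob_bracket (twist L) N m (twist L x) (twist L y) (twist L z)"
      by (simp add: Ob_bracket_def hom_jacobi_sum_def tw.neg tw.sum tw.add twist_bracket case_prod_unfold)
  qed
qed

lemma delta_HL_jacobi_coeff:
  fixes L :: "('k::field, 'a::ab_group_add) hom_lie"
  assumes vs: "vector_space (smul L)" and m: "\<And>p. cochain2 (m p) \<in> cochains L L 2"
    and zero: "m 0 = bracket L"
    and lower: "\<forall>k<n. \<forall>x y z. jacobi_coeff (twist L) m k x y z = 0"
  shows "delta_HL L L id 3 (cochain3 (\<lambda>x y z. - jacobi_coeff (twist L) m n x y z)) = (\<lambda>_. 0)"
proof
  fix xs
  interpret skew_family "twist L" m
    using m by (rule skew_family_cochains)
  note minus = minus_right[of 0, unfolded zero]
  note cocycle = jacobi_coeff_cocycle[OF lower, unfolded zero]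
  show "delta_HL L L id 3 (cochain3 (\<lambda>x y z. - jacobi_coeff (twist L) m n x y z)) xs = 0"
  proof (cases "length xs = 4")
    case True
    then obtain x y z w where xs: "xs = [x, y, z, w]"
      by (auto simp: length_eq_4_iff)
    \<comment> \<open>Pulling out the common sign exposes literally the left side of
      \<open>cocycle\<close>.\<close>
    have uminus_sum: "- c1 - - c2 + - c3 - - c4 - - c5 + - c6 - - c7 - - c8 + - c9 - - c10
        = - (c1 - c2 + c3 - c4 - c5 + c6 - c7 - c8 + c9 - c10)"
      for c1 c2 c3 c4 c5 c6 c7 c8 c9 c10 :: 'a
      by simp
    show ?thesis
      unfolding delta_HL_cochain3[OF vs] xs list.case id_apply minus uminus_sum
        cocycle[of x y z w] by (rule minus_zero)
  qed (simp add: delta_HL_def)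
qed

text \<open>Proved for the full defect, whose skew symmetry is already known; for the truncated
  families its coefficient N + 1 is \<open>Ob_morphism\<close>.\<close>

lemma morphism_defect_in_cochains:
  assumes mL: "\<And>p. cochain2 (mL p) \<in> cochains L L 2" and mG: "\<And>p. cochain2 (mG p) \<in> cochains G G 2"
    and ph: "\<And>i. cochain1 (ph i) \<in> cochains L G 1"
    and tw: "Vector_Spaces.linear (smul G) (smul G) (twist G)"
  shows "cochain2 (morphism_defect mL mG ph n) \<in> cochains L G 2"
proof -
  have lin: "Vector_Spaces.linear (smul L) (smul G) (ph i)" for i
    using ph[of i] by (simp only: cochain1_in_cochains_iff)
  interpret skew_family_pair "twist L" mL "twist G" mG ph
    using mL mG ph by (rule skew_family_pair_cochains)
  interpret tw: Vector_Spaces.linear "smul G" "smul G" "twist G"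
    by (rule tw)
  \<comment> \<open>This interpretation provides the vector space structure on the source.\<close>
  interpret ph0: Vector_Spaces.linear "smul L" "smul G" "ph 0"
    by (rule lin)
  have vs: "vector_space (smul L)" "vector_space (smul G)" ..
  show ?thesis
  proof (rule cochain2_in_cochainsI)
    fix x y
    show "Vector_Spaces.linear (smul L) (smul G) (\<lambda>x. morphism_defect mL mG ph n x y)"
      unfolding morphism_defect_def case_prod_unfold
      by (intro linear_diff_fun linear_sum_fun vs linear_comp_fun[OF lin cochain2_in_cochainsD(1)[OF mL]]
          linear_comp_fun[OF cochain2_in_cochainsD(1)[OF mG] lin])
    show "morphism_defect mL mG ph n y x = - morphism_defect mL mG ph n x y"
      by (rule morphism_defect_skew)
    show "twist G (morphism_defect mL mG ph n x y) = morphism_defect mL mG ph n (twist L x) (twist L y)"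
      by (simp add: morphism_defect_def tw.diff tw.sum L.twist_bracket G.twist_bracket case_prod_unfold
          flip: ph_twist)
  qed
qed

section \<open>Extension by one order\<close>

text \<open>The two pairs with a zero entry are exactly those in which the coefficient of index N +
  1 occurs, and each contains it once. The remaining pairs form the obstruction, which already
  carries a minus sign.\<close>

lemma jacobi_coeff_Suc:
  "jacobi_coeff a m (Suc N) x y z = hom_jacobi_sum a (m 0) (m (Suc N)) x y z
    + hom_jacobi_sum a (m (Suc N)) (m 0) x y z - Ob_bracket a N m x y z"
proof -
  have fin: "finite {(p, q). p + q = N + 1 \<and> 0 < p \<and> 0 < q}"
    by (rule finite_subset[OF _ finite_add_eq(1)[of "N + 1"]]) auto
  have "{(p, q). p + q = Suc N}
      = insert (0, Suc N) (insert (Suc N, 0) {(p, q). p + q = N + 1 \<and> 0 < p \<and> 0 < q})"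
    by auto
  then show ?thesis
    using fin by (simp add: jacobi_coeff_def Ob_bracket_def)
qed

text \<open>The triples with just one positive entry have N + 1 in that place. Together with the
  terms i = 0 and i = N + 1 of the first sum they contain all coefficients of index N + 1.\<close>

lemma morphism_defect_Suc:
  "morphism_defect mL mG ph (Suc N) x y = ph 0 (mL (Suc N) x y) + ph (Suc N) (mL 0 x y)
    - mG (Suc N) (ph 0 x) (ph 0 y) - mG 0 (ph (Suc N) x) (ph 0 y) - mG 0 (ph 0 x) (ph (Suc N) y)
    + Ob_morphism N mL mG ph x y"
proof -
  let ?B = "{(i, j, k). i + j + k = N + 1 \<and> (i > 0 \<and> j > 0 \<or> i > 0 \<and> k > 0 \<or> j > 0 \<and> k > 0)}"
  have fin: "finite ?B"
    by (rule finite_subset[OF _ finite_add_eq(2)[of "N + 1"]]) auto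
  have "{(i, j, k). i + j + k = Suc N}
      = insert (0, 0, Suc N) (insert (Suc N, 0, 0) (insert (0, Suc N, 0) ?B))"
    by auto
  moreover have "(\<Sum>i\<in>{0..Suc N}. ph i (mL (Suc N - i) x y)) = ph 0 (mL (Suc N) x y)
      + (\<Sum>i\<in>{1..N}. ph i (mL (N + 1 - i) x y)) + ph (Suc N) (mL 0 x y)"
    by (simp add: sum.atLeast_Suc_atMost)
  ultimately show ?thesis
    using fin by (simp add: morphism_defect_def Ob_morphism_def)
qed

text \<open>This and the next three congruences allow a family to be changed above N, either to
  adjoin a new coefficient or to truncate.\<close>

lemma jacobi_coeff_cong:
  assumes "\<And>i. i \<le> n \<Longrightarrow> m i = m' i"
  shows "jacobi_coeff a m n = jacobi_coeff a m' n"
  by (intro ext) (auto simp: jacobi_coeff_def assms intro!: sum.cong)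

lemma morphism_defect_cong:
  assumes "\<And>i. i \<le> n \<Longrightarrow> mL i = mL' i" "\<And>i. i \<le> n \<Longrightarrow> mG i = mG' i" "\<And>i. i \<le> n \<Longrightarrow> ph i = ph' i"
  shows "morphism_defect mL mG ph n = morphism_defect mL' mG' ph' n"
  by (intro ext) (auto simp: morphism_defect_def assms intro!: sum.cong arg_cong2[of _ _ _ _ minus])

text \<open>Although p + q = N + 1, positivity of both indices keeps each of them at most N.\<close>

lemma Ob_bracket_cong:
  assumes "\<And>i. i \<le> N \<Longrightarrow> m i = m' i"
  shows "Ob_bracket a N m = Ob_bracket a N m'"
  by (intro ext) (auto simp: Ob_bracket_def assms intro!: sum.cong)

lemma Ob_morphism_cong:
  assumes "\<And>i. i \<le> N \<Longrightarrow> mL i = mL' i" "\<And>i. i \<le> N \<Longrightarrow> mG i = mG' i" "\<And>i. i \<le> N \<Longrightarrow> ph i = ph' i"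
  shows "Ob_morphism N mL mG ph = Ob_morphism N mL' mG' ph'"
  by (intro ext) (auto simp: Ob_morphism_def assms intro!: sum.cong arg_cong2[of _ _ _ _ minus])

lemma is_deformation_iff:
  "is_deformation L G \<phi> N mL mG ph \<longleftrightarrow>
     mL 0 = bracket L \<and> mG 0 = bracket G \<and> ph 0 = \<phi> \<and>
     (\<forall>i\<le>N. cochain2 (mL i) \<in> cochains L L 2) \<and>
     (\<forall>i\<le>N. cochain2 (mG i) \<in> cochains G G 2) \<and>
     (\<forall>i\<le>N. cochain1 (ph i) \<in> cochains L G 1) \<and>
     (\<forall>n\<le>N. \<forall>x y z. jacobi_coeff (twist L) mL n x y z = 0) \<and>
     (\<forall>n\<le>N. \<forall>x y z. jacobi_coeff (twist G) mG n x y z = 0) \<and>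
     (\<forall>n\<le>N. \<forall>x y. morphism_defect mL mG ph n x y = 0)"
proof -
  have "p \<circ> twist L = twist G \<circ> p \<longleftrightarrow> (\<forall>x. twist G (p x) = p (twist L x))" for p
    by (auto simp: fun_eq_iff)
  then show ?thesis
    unfolding is_deformation_def cochain1_in_cochains_iff jacobi_coeff_def morphism_defect_def
    by simp
qed

text \<open>The conditions up to order N are inherited, so only those of order N + 1 remain. They
  are solved for the obstruction, with the new coefficients on the left in the form of the
  components of a coboundary.\<close>

lemma is_deformation_Suc_iff:
  assumes "is_deformation L G \<phi> N mL mG ph"
  shows "is_deformation L G \<phi> (Suc N) (mL(Suc N := bL)) (mG(Suc N := bG)) (ph(Suc N := p)) \<longleftrightarrow>
    cochain2 bL \<in> cochains L L 2 \<and> cochain2 bG \<in> cochains G G 2 \<and> cochain1 p \<in> cochains L G 1 \<and>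
    (\<forall>x y z. hom_jacobi_sum (twist L) (bracket L) bL x y z
      + hom_jacobi_sum (twist L) bL (bracket L) x y z = Ob_bracket (twist L) N mL x y z) \<and>
    (\<forall>x y z. hom_jacobi_sum (twist G) (bracket G) bG x y z
      + hom_jacobi_sum (twist G) bG (bracket G) x y z = Ob_bracket (twist G) N mG x y z) \<and>
    (\<forall>x y. bracket G (p x) (\<phi> y) + bracket G (\<phi> x) (p y) - p (bracket L x y)
      - (\<phi> (bL x y) - bG (\<phi> x) (\<phi> y)) = Ob_morphism N mL mG ph x y)"
    (is "?lhs \<longleftrightarrow> ?rhs")
proof -
  let ?mL = "mL(Suc N := bL)" and ?mG = "mG(Suc N := bG)" and ?ph = "ph(Suc N := p)"
  have zero: "mL 0 = bracket L" "mG 0 = bracket G" "ph 0 = \<phi>"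
    using assms by (simp_all add: is_deformation_iff)
  have JL: "jacobi_coeff (twist L) ?mL n = jacobi_coeff (twist L) mL n"
    and JG: "jacobi_coeff (twist G) ?mG n = jacobi_coeff (twist G) mG n"
    and E: "morphism_defect ?mL ?mG ?ph n = morphism_defect mL mG ph n" if "n \<le> N" for n
    using that by (auto intro!: jacobi_coeff_cong morphism_defect_cong)
  have ObL: "Ob_bracket (twist L) N ?mL = Ob_bracket (twist L) N mL"
    and ObG: "Ob_bracket (twist G) N ?mG = Ob_bracket (twist G) N mG"
    and Obp: "Ob_morphism N ?mL ?mG ?ph = Ob_morphism N mL mG ph"
    by (auto intro!: Ob_bracket_cong Ob_morphism_cong)
  have "?lhs \<longleftrightarrow> cochain2 bL \<in> cochains L L 2 \<and> cochain2 bG \<in> cochains G G 2 \<and>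
      cochain1 p \<in> cochains L G 1 \<and>
      (\<forall>x y z. jacobi_coeff (twist L) ?mL (Suc N) x y z = 0) \<and>
      (\<forall>x y z. jacobi_coeff (twist G) ?mG (Suc N) x y z = 0) \<and>
      (\<forall>x y. morphism_defect ?mL ?mG ?ph (Suc N) x y = 0)"
    using assms unfolding is_deformation_iff le_Suc_eq
    by (auto simp: JL JG E simp del: One_nat_def)
  also have "\<dots> \<longleftrightarrow> ?rhs"
  proof -
    have "morphism_defect ?mL ?mG ?ph (Suc N) x y = Ob_morphism N mL mG ph x y
        - (bracket G (p x) (\<phi> y) + bracket G (\<phi> x) (p y) - p (bracket L x y)
          - (\<phi> (bL x y) - bG (\<phi> x) (\<phi> y)))" for x y
      by (simp add: morphism_defect_Suc Obp zero)
    then have "morphism_defect ?mL ?mG ?ph (Suc N) x y = 0 \<longleftrightarrow> bracket G (p x) (\<phi> y)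
        + bracket G (\<phi> x) (p y) - p (bracket L x y) - (\<phi> (bL x y) - bG (\<phi> x) (\<phi> y))
        = Ob_morphism N mL mG ph x y" for x y
      by (metis right_minus_eq)
    then show ?thesis
      by (simp add: jacobi_coeff_Suc ObL ObG zero)
  qed
  finally show ?thesis .
qed

text \<open>The coboundary of f is the first-order variation of the Jacobiator when the bracket is
  perturbed by f. The signs of the two formulas agree after reversing the brackets that are out of
  cyclic order.\<close>

lemma delta_HL_bracket_cochain:
  assumes L: "multiplicative_hom_lie_algebra L" and f: "cochain2 f \<in> cochains L L 2"
  shows "delta_HL L L id 2 (cochain2 f) = cochain3 (\<lambda>x y z.
    hom_jacobi_sum (twist L) (bracket L) f x y z + hom_jacobi_sum (twist L) f (bracket L) x y z)"
proof -
  have vs: "vector_space (smul L)" and sk: "bracket L x y = - bracket L y x"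
    and "Vector_Spaces.linear (smul L) (smul L) (bracket L x)" for x y
    using L unfolding multiplicative_hom_lie_algebra_def hom_lie_algebra_def by blast+
  \<comment> \<open>A constant family makes the sign rules of the locale available for the single
    map f.\<close>
  interpret f: skew_family "twist L" "\<lambda>_. f"
    using f by (rule skew_family_cochains)
  interpret lin: Vector_Spaces.linear "smul L" "smul L" "bracket L x" for x
    by fact
  show ?thesis
    unfolding delta_HL_cochain2[OF vs] cochain3_eq_iff hom_jacobi_sum_def
  proof (intro allI)
    fix x y z
    show "bracket L (id (twist L x)) (f y z) - bracket L (id (twist L y)) (f x z)
        + bracket L (id (twist L z)) (f x y) - f (bracket L x y) (twist L z)
        + f (bracket L x z) (twist L y) - f (bracket L y z) (twist L x)
      = f (twist L x) (bracket L y z) + f (twist L y) (bracket L z x) + f (twist L z) (bracket L x y)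
        + (bracket L (twist L x) (f y z) + bracket L (twist L y) (f z x) + bracket L (twist L z) (f x y))"
      by (simp add: f.skew[of z x] sk[of z x] f.skew[of "bracket L _ _" "twist L _"]
          f.minus_right lin.neg algebra_simps)
  qed
qed

section \<open>The obstruction cocycle and the extension criterion\<close>

theorem theorem4p15:
  fixes L :: "('k::{alg_closed_field, field_char_0}, 'a::ab_group_add) hom_lie"
    and G :: "('k, 'b::ab_group_add) hom_lie"
    and \<phi> :: "'a \<Rightarrow> 'b"
    and N :: nat
    and mL :: "nat \<Rightarrow> 'a \<Rightarrow> 'a \<Rightarrow> 'a"
    and mG :: "nat \<Rightarrow> 'b \<Rightarrow> 'b \<Rightarrow> 'b"
    and ph :: "nat \<Rightarrow> 'a \<Rightarrow> 'b"
  assumes "multiplicative_hom_lie_algebra L"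
    and "multiplicative_hom_lie_algebra G"
    and "hom_lie_morphism L G \<phi>"
    and "N \<ge> 1"
    and "is_deformation L G \<phi> N mL mG ph"
  shows "Ob L G N mL mG ph \<in> mor_cocycles3 L G \<phi> \<and>
    (extends_to_next_order L G \<phi> N mL mG ph \<longleftrightarrow>
       Ob L G N mL mG ph \<in> mor_coboundaries3 L G \<phi>)"
proof
  note L = assms(1) and G = assms(2) and def = assms(5)
  have vsL: "vector_space (smul L)" and vsG: "vector_space (smul G)"
    and twL: "Vector_Spaces.linear (smul L) (smul L) (twist L)"
    and twG: "Vector_Spaces.linear (smul G) (smul G) (twist G)"
    using L G unfolding multiplicative_hom_lie_algebra_def hom_lie_algebra_def by blast+
  interpret vG: vector_space "smul G" by (rule vsG)
  interpret tL: Vector_Spaces.linear "smul L" "smul L" "twist L" by (rule twL)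
  interpret tG: Vector_Spaces.linear "smul G" "smul G" "twist G" by (rule twG)
  have bracket_skew: "bracket G u v = - bracket G v u" for u v
    using G unfolding multiplicative_hom_lie_algebra_def hom_lie_algebra_def by blast
  interpret \<phi>: Vector_Spaces.linear "smul L" "smul G" \<phi>
    using assms(3) by (simp add: hom_lie_morphism_def)
  \<comment> \<open>Zero maps will fill the families above N, so that cochain membership holds at
    every index.\<close>
  have zero_cochains: "cochain2 (\<lambda>_ _. 0) \<in> cochains L L 2"
    "cochain2 (\<lambda>_ _. 0) \<in> cochains G G 2" "cochain1 (\<lambda>_. 0) \<in> cochains L G 1"
    by (auto intro!: cochain2_in_cochainsI simp: cochain1_in_cochains_iff Vector_Spaces.linear_iff
        vsL vsG simp del: One_nat_def)

  txt \<open>The values beyond \<open>N\<close> are arbitrary; truncating makes the Jacobiators and the defect at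
    \<open>N + 1\<close> equal to the obstruction, up to sign.\<close>
  define kL where "kL i = (if i \<le> N then mL i else (\<lambda>_ _. 0))" for i
  define kG where "kG i = (if i \<le> N then mG i else (\<lambda>_ _. 0))" for i
  define kp where "kp i = (if i \<le> N then ph i else (\<lambda>_. 0))" for i
  have zero: "kL 0 = bracket L" "kG 0 = bracket G" "kp 0 = \<phi>"
    and kL: "cochain2 (kL i) \<in> cochains L L 2" and kG: "cochain2 (kG i) \<in> cochains G G 2"
    and kp: "cochain1 (kp i) \<in> cochains L G 1" for i
    using def zero_cochains by (simp_all add: is_deformation_iff kL_def kG_def kp_def)
  interpret skew_family_pair "twist L" kL "twist G" kG kp
    using kL kG kp by (rule skew_family_pair_cochains)
  have JL: "jacobi_coeff (twist L) kL k = jacobi_coeff (twist L) mL k"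
    and JG: "jacobi_coeff (twist G) kG k = jacobi_coeff (twist G) mG k"
    and E: "morphism_defect kL kG kp k = morphism_defect mL mG ph k" if "k \<le> N" for k
    using that by (auto simp: kL_def kG_def kp_def intro!: jacobi_coeff_cong morphism_defect_cong)
  have lower: "\<forall>k<Suc N. \<forall>x y z. jacobi_coeff (twist L) kL k x y z = 0"
    "\<forall>k<Suc N. \<forall>x y z. jacobi_coeff (twist G) kG k x y z = 0"
    "\<forall>k<Suc N. \<forall>x y. morphism_defect kL kG kp k x y = 0"
    using def by (simp_all add: JL JG E is_deformation_iff less_Suc_eq_le)
  have ObL: "Ob_bracket (twist L) N mL x y z = - jacobi_coeff (twist L) kL (Suc N) x y z" for x y z
    using Ob_bracket_cong[of N mL kL]
    by (simp add: jacobi_coeff_Suc hom_jacobi_sum_def kL_def[of "Suc N"]) (simp add: kL_def)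
  have ObG: "Ob_bracket (twist G) N mG x y z = - jacobi_coeff (twist G) kG (Suc N) x y z" for x y z
    using Ob_bracket_cong[of N mG kG]
    by (simp add: jacobi_coeff_Suc hom_jacobi_sum_def kG_def[of "Suc N"]) (simp add: kG_def)
  have Obp: "Ob_morphism N mL mG ph x y = morphism_defect kL kG kp (Suc N) x y" for x y
    using Ob_morphism_cong[of N mL kL mG kG ph kp]
    by (simp add: morphism_defect_Suc kL_def[of "Suc N"] kG_def[of "Suc N"] kp_def[of "Suc N"])
      (simp add: kL_def kG_def kp_def)

  show "Ob L G N mL mG ph \<in> mor_cocycles3 L G \<phi>"
  proof -
    have "Ob_bracket (twist L) N mL = Ob_bracket (twist L) N kL"
      "Ob_bracket (twist G) N mG = Ob_bracket (twist G) N kG"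
      by (auto simp: kL_def kG_def intro!: Ob_bracket_cong)
    then have "Ob L G N mL mG ph \<in> mor_cochains L G 3"
      using Ob_bracket_in_cochains[OF kL twL, where N = N] Ob_bracket_in_cochains[OF kG twG, where N = N]
        morphism_defect_in_cochains[OF kL kG kp twG, where n = "Suc N"]
      by (simp add: Ob_def mor_cochains_def Obp[abs_def])
    moreover have "delta_HL L L id 3 (cochain3 (Ob_bracket (twist L) N mL)) = (\<lambda>_. 0)"
      unfolding ObL[abs_def] using vsL kL zero(1) lower(1) by (rule delta_HL_jacobi_coeff)
    moreover have "delta_HL G G id 3 (cochain3 (Ob_bracket (twist G) N mG)) = (\<lambda>_. 0)"
      unfolding ObG[abs_def] using vsG kG zero(2) lower(2) by (rule delta_HL_jacobi_coeff)
    \<comment> \<open>The sign of the mixed term is +1 in degree three. The first two components are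
      the negatives of the Jacobiators, so this term cancels the right side of
      \<open>morphism_defect_cocycle\<close>.\<close>
    moreover have "delta_HL L G \<phi> 2 (cochain2 (Ob_morphism N mL mG ph)) xs
        + smul G ((- 1) ^ 2) (\<phi> (cochain3 (Ob_bracket (twist L) N mL) xs)
          - cochain3 (Ob_bracket (twist G) N mG) (map \<phi> xs)) = 0" for xs
    proof (cases "length xs = 3")
      case True
      then obtain x y z where xs: "xs = [x, y, z]"
        by (auto simp: length_eq_3_iff)
      show ?thesis
        unfolding delta_HL_cochain2[OF vsG] xs cochain3_def list.case list.map ObL ObG Obp
          morphism_defect_cocycle[OF lower(3,1,2), of x y z, unfolded zero]
        by (simp add: \<phi>.neg)
    qed (auto simp: delta_HL_cochain2[OF vsG] cochain3_def split: list.split)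
    ultimately show ?thesis
      by (simp add: mor_cocycles3_def Ob_def mor_delta_def)
  qed

  \<comment> \<open>Compared component by component, the coboundary equation becomes the three order
    N + 1 equations of \<open>is_deformation_Suc_iff\<close>.\<close>
  have eq: "Ob L G N mL mG ph = mor_delta L G \<phi> 2 (cochain2 bL, cochain2 bG, cochain1 p) \<longleftrightarrow>
      (\<forall>x y z. hom_jacobi_sum (twist L) (bracket L) bL x y z
        + hom_jacobi_sum (twist L) bL (bracket L) x y z = Ob_bracket (twist L) N mL x y z) \<and>
      (\<forall>x y z. hom_jacobi_sum (twist G) (bracket G) bG x y z
        + hom_jacobi_sum (twist G) bG (bracket G) x y z = Ob_bracket (twist G) N mG x y z) \<and>
      (\<forall>x y. bracket G (p x) (\<phi> y) + bracket G (\<phi> x) (p y) - p (bracket L x y)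
        - (\<phi> (bL x y) - bG (\<phi> x) (\<phi> y)) = Ob_morphism N mL mG ph x y)"
    if "cochain2 bL \<in> cochains L L 2" "cochain2 bG \<in> cochains G G 2" for bL bG p
  proof -
    \<comment> \<open>In degree two the mixed term has sign -1; skew symmetry of the bracket of G
      turns the negative term of the degree-one coboundary into
      \<open>bracket G (p x) (\<phi> y)\<close>.\<close>
    have "delta_HL L G \<phi> (2 - 1) (cochain1 p) xs
          + smul G ((- 1) ^ (2 - 1)) (\<phi> (cochain2 bL xs) - cochain2 bG (map \<phi> xs))
        = cochain2 (\<lambda>x y. bracket G (p x) (\<phi> y) + bracket G (\<phi> x) (p y) - p (bracket L x y)
            - (\<phi> (bL x y) - bG (\<phi> x) (\<phi> y))) xs" for xs
      using delta_HL_cochain1[OF vsG, of L \<phi> p]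
      by (auto simp: cochain2_def bracket_skew[of "\<phi> _" "p _"] split: list.split)
    then show ?thesis
      by (auto simp: Ob_def mor_delta_def cochain3_eq_iff cochain2_eq_iff delta_HL_bracket_cochain[OF L that(1)]
          delta_HL_bracket_cochain[OF G that(2)])
  qed
  show "extends_to_next_order L G \<phi> N mL mG ph \<longleftrightarrow>
       Ob L G N mL mG ph \<in> mor_coboundaries3 L G \<phi>"
  proof -
    have "Ob L G N mL mG ph \<in> mor_coboundaries3 L G \<phi> \<longleftrightarrow>
      (\<exists>bL bG p. (cochain2 bL, cochain2 bG, cochain1 p) \<in> mor_cochains L G 2 \<and>
        Ob L G N mL mG ph = mor_delta L G \<phi> 2 (cochain2 bL, cochain2 bG, cochain1 p))"
    proof
      assume "Ob L G N mL mG ph \<in> mor_coboundaries3 L G \<phi>"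
      then obtain f1 f2 f3 where f: "(f1, f2, f3) \<in> mor_cochains L G 2"
        "Ob L G N mL mG ph = mor_delta L G \<phi> 2 (f1, f2, f3)"
        by (auto simp: mor_coboundaries3_def)
      moreover have "f1 = cochain2 (\<lambda>x y. f1 [x, y])" "f2 = cochain2 (\<lambda>x y. f2 [x, y])"
        "f3 = cochain1 (\<lambda>x. f3 [x])"
        using f(1) by (auto simp: mor_cochains_def intro: cochains_2_eq_cochain2 cochains_1_eq_cochain1)
      ultimately show "\<exists>bL bG p. (cochain2 bL, cochain2 bG, cochain1 p) \<in> mor_cochains L G 2 \<and>
        Ob L G N mL mG ph = mor_delta L G \<phi> 2 (cochain2 bL, cochain2 bG, cochain1 p)"
        by metis
    qed (auto simp: mor_coboundaries3_def)
    \<comment> \<open>The equivalence holds witness by witness: a 2-cochain extends the deformation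
      exactly when its coboundary is the obstruction.\<close>
    also have "\<dots> \<longleftrightarrow> extends_to_next_order L G \<phi> N mL mG ph"
    proof -
      have mem: "(cochain2 bL, cochain2 bG, cochain1 p) \<in> mor_cochains L G 2 \<longleftrightarrow>
          cochain2 bL \<in> cochains L L 2 \<and> cochain2 bG \<in> cochains G G 2 \<and> cochain1 p \<in> cochains L G 1"
        for bL bG p
        by (simp add: mor_cochains_def)
      show ?thesis
        unfolding extends_to_next_order_def Suc_eq_plus1[symmetric] is_deformation_Suc_iff[OF def] mem
        by (intro ex_cong1) (use eq in blast)
    qed
    finally show ?thesis ..
  qed
qed

end
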